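(* Let $A$ be a vector space and let $\mathfrak{B}_d$ be the bilinear form on $A\oplus A^*$ defined by $$\mathfrak{B}_d(x+a^*,y+b^* )=\langle y,a^*\rangle-\langle x,b^*\rangle,\qquad x,y\in A,\ a^*,b^*\in A^*.$$ (a) If $(A,\cdot)$ is an associative algebra, then $A\oplus A^*$ with the products $$(x+a^* )\rhd(y+b^* )=x\cdot y-R_{\cdot}^*(x)b^*,\qquad (x+a^* )\lhd(y+b^* )=x\cdot y-L_{\cdot}^*(y)a^*$$ and the form $\mathfrak{B}_d$ is a skew-symmetric Frobenius dialgebra. (b) If $(A,\rhd,\lhd)$ is a dialgebra, then $A\oplus A^*$ with the products $$(x+a^* )\rhd(y+b^* )=x\rhd y-R_{\lhd}^*(x)b^*+(L_{\lhd}^*-L_{\rhd}^* )(y)a^*,$$ $$(x+a^* )\lhd(y+b^* )=x\lhd y+(R_{\rhd}^*-R_{\lhd}^* )(x)b^*-L_{\rhd}^*(y)a^*$$ and the form $\mathfrak{B}_d$ is a skew-symmetric Frobenius dialgebra.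
   Context: All vector spaces and algebras are finite-dimensional over a field $\mathbb F$ of characteristic $0$; algebras are not assumed unital. A dialgebra is a triple $(A,\rhd,\lhd)$ where $A$ is a vector space and $\rhd,\lhd$ are associative bilinear products on $A$ such that for all $x,y,z\in A$: $(x\lhd y)\lhd z=x\lhd(y\rhd z)$, $(x\rhd y)\lhd z=x\rhd(y\lhd z)$, $(x\lhd y)\rhd z=x\rhd(y\rhd z)$. A bilinear form $\mathfrak{B}$ on a dialgebra is invariant if $\mathfrak{B}(x\rhd y,z)=\mathfrak{B}(x,y\rhd z-y\lhd z)$ and $\mathfrak{B}(x\lhd y,z)=\mathfrak{B}(x,y\rhd z)$ for all $x,y,z$. A skew-symmetric Frobenius dialgebra is a dialgebra equipped with a nondegenerate skew-symmetric invariant bilinear form. For a bilinear product $\diamond$ on $A$: $L_\diamond(x)y=x\diamond y=R_\diamond(y)x$. For a linear map $\varphi:A\to\mathrm{End}(V)$, $\varphi^*:A\to\mathrm{End}(V^* )$ is given by $\langle\varphi^*(x)v^*,u\rangle=-\langle v^*,\varphi(x)u\rangle$ (note the sign). *)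

theory Defs
  imports "HOL-Analysis.Product_Vector" "HOL-Library.Function_Algebras"
begin

text \<open>
  A vector space over the field \<open>'f\<close> of characteristic \<open>0\<close> is a subspace \<open>V\<close> of an
  ambient type that is a vector space under \<open>scale\<close>; the choice \<open>V = UNIV\<close> is allowed.
  Carriers are needed because the dual space is a proper subset of a function type.
  Structure maps such as products and forms are total functions on the ambient type,
  and only their values on the carrier are meaningful.
\<close>

locale fd_vector_space = vector_space scale
  for scale :: "'f::field_char_0 \<Rightarrow> 'v::ab_group_add \<Rightarrow> 'v" +
  fixes V :: "'v set"
  assumes finite_dim: "\<exists>B. finite B \<and> span B = V"

definition linear_map_on ::
  "('f::field_char_0 \<Rightarrow> 'v::ab_group_add \<Rightarrow> 'v) \<Rightarrow> 'v set \<Rightarrow>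
   ('f \<Rightarrow> 'w::ab_group_add \<Rightarrow> 'w) \<Rightarrow> 'w set \<Rightarrow> ('v \<Rightarrow> 'w) \<Rightarrow> bool"
  where "linear_map_on s V t W f \<longleftrightarrow>
    (\<forall>x\<in>V. f x \<in> W) \<and>
    (\<forall>x\<in>V. \<forall>y\<in>V. f (x + y) = f x + f y) \<and>
    (\<forall>c. \<forall>x\<in>V. f (s c x) = t c (f x))"

definition bilinear_map_on ::
  "('f::field_char_0 \<Rightarrow> 'v::ab_group_add \<Rightarrow> 'v) \<Rightarrow> 'v set \<Rightarrow>
   ('f \<Rightarrow> 'w::ab_group_add \<Rightarrow> 'w) \<Rightarrow> 'w set \<Rightarrow> ('v \<Rightarrow> 'v \<Rightarrow> 'w) \<Rightarrow> bool"
  where "bilinear_map_on s V t W b \<longleftrightarrow>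
    (\<forall>x\<in>V. linear_map_on s V t W (b x)) \<and>
    (\<forall>y\<in>V. linear_map_on s V t W (\<lambda>x. b x y))"

locale associative_algebra = fd_vector_space scale A
  for scale :: "'f::field_char_0 \<Rightarrow> 'v::ab_group_add \<Rightarrow> 'v" and A :: "'v set" +
  fixes mult :: "'v \<Rightarrow> 'v \<Rightarrow> 'v" (infixl "\<cdot>" 70)
  assumes bilinear_mult: "bilinear_map_on scale A scale A mult"
    and mult_assoc: "\<lbrakk>x \<in> A; y \<in> A; z \<in> A\<rbrakk> \<Longrightarrow> (x \<cdot> y) \<cdot> z = x \<cdot> (y \<cdot> z)"

locale dialgebra =
  R: associative_algebra scale A rt + L: associative_algebra scale A lt
  for scale :: "'f::field_char_0 \<Rightarrow> 'v::ab_group_add \<Rightarrow> 'v" and A :: "'v set"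
    and rt :: "'v \<Rightarrow> 'v \<Rightarrow> 'v" (infixl "\<rhd>" 70)
    and lt :: "'v \<Rightarrow> 'v \<Rightarrow> 'v" (infixl "\<lhd>" 70) +
  assumes lt_lt_eq_lt_rt: "\<lbrakk>x \<in> A; y \<in> A; z \<in> A\<rbrakk> \<Longrightarrow> (x \<lhd> y) \<lhd> z = x \<lhd> (y \<rhd> z)"
    and rt_lt_assoc: "\<lbrakk>x \<in> A; y \<in> A; z \<in> A\<rbrakk> \<Longrightarrow> (x \<rhd> y) \<lhd> z = x \<rhd> (y \<lhd> z)"
    and lt_rt_eq_rt_rt: "\<lbrakk>x \<in> A; y \<in> A; z \<in> A\<rbrakk> \<Longrightarrow> (x \<lhd> y) \<rhd> z = x \<rhd> (y \<rhd> z)"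

locale skew_frobenius_dialgebra = dialgebra scale A rt lt
  for scale :: "'f::field_char_0 \<Rightarrow> 'v::ab_group_add \<Rightarrow> 'v" and A :: "'v set"
    and rt :: "'v \<Rightarrow> 'v \<Rightarrow> 'v" (infixl "\<rhd>" 70)
    and lt :: "'v \<Rightarrow> 'v \<Rightarrow> 'v" (infixl "\<lhd>" 70) +
  fixes B :: "'v \<Rightarrow> 'v \<Rightarrow> 'f"
  assumes bilinear_form: "bilinear_map_on scale A (*) UNIV B"
    and skew_symmetric: "\<lbrakk>x \<in> A; y \<in> A\<rbrakk> \<Longrightarrow> B x y = - B y x"
    and nondegenerate_left: "\<lbrakk>x \<in> A; \<forall>y\<in>A. B x y = 0\<rbrakk> \<Longrightarrow> x = 0"
    and nondegenerate_right: "\<lbrakk>y \<in> A; \<forall>x\<in>A. B x y = 0\<rbrakk> \<Longrightarrow> y = 0"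
    and invariant_rt: "\<lbrakk>x \<in> A; y \<in> A; z \<in> A\<rbrakk> \<Longrightarrow> B (x \<rhd> y) z = B x (y \<rhd> z - y \<lhd> z)"
    and invariant_lt: "\<lbrakk>x \<in> A; y \<in> A; z \<in> A\<rbrakk> \<Longrightarrow> B (x \<lhd> y) z = B x (y \<rhd> z)"

text \<open>
  Functionals on \<open>V\<close> are extended by \<open>0\<close> outside \<open>V\<close>, so that each functional on \<open>V\<close> is
  represented by exactly one function; the pairing of \<open>v\<close> with \<open>f\<close> is \<open>f v\<close>.
\<close>

definition dual_space ::
  "('f::field_char_0 \<Rightarrow> 'v::ab_group_add \<Rightarrow> 'v) \<Rightarrow> 'v set \<Rightarrow> ('v \<Rightarrow> 'f) set"
  where "dual_space s V = {f. linear_map_on s V (*) UNIV f \<and> (\<forall>x. x \<notin> V \<longrightarrow> f x = 0)}"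

definition dual_scale :: "'f::field_char_0 \<Rightarrow> ('v \<Rightarrow> 'f) \<Rightarrow> ('v \<Rightarrow> 'f)"
  where "dual_scale c f = (\<lambda>x. c * f x)"

definition left_mult :: "('v \<Rightarrow> 'v \<Rightarrow> 'v) \<Rightarrow> 'v \<Rightarrow> 'v \<Rightarrow> 'v"
  where "left_mult m x y = m x y"

definition right_mult :: "('v \<Rightarrow> 'v \<Rightarrow> 'v) \<Rightarrow> 'v \<Rightarrow> 'v \<Rightarrow> 'v"
  where "right_mult m y x = m x y"

text \<open>The map \<open>\<phi>\<^sup>*\<close> associated with \<open>\<phi> : A \<rightarrow> End(V)\<close>, including the sign.\<close>

definition dual_map :: "'v set \<Rightarrow> ('a \<Rightarrow> 'v \<Rightarrow> 'v) \<Rightarrow> 'a \<Rightarrow> ('v \<Rightarrow> 'f::field_char_0) \<Rightarrow> ('v \<Rightarrow> 'f)"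
  where "dual_map V \<phi> x f = (\<lambda>u. if u \<in> V then - f (\<phi> x u) else 0)"

text \<open>Scalar multiplication on the direct sum of \<open>V\<close> and its dual, whose carrier is
  \<open>V \<times> dual_space s V\<close>; the element \<open>x + a\<^sup>*\<close> is the pair \<open>(x, a)\<close>.\<close>

definition double_scale ::
  "('f::field_char_0 \<Rightarrow> 'v::ab_group_add \<Rightarrow> 'v) \<Rightarrow> 'f \<Rightarrow> 'v \<times> ('v \<Rightarrow> 'f) \<Rightarrow> 'v \<times> ('v \<Rightarrow> 'f)"
  where "double_scale s = module_prod.scale s dual_scale"

definition double_form :: "'v \<times> ('v \<Rightarrow> 'f::field_char_0) \<Rightarrow> 'v \<times> ('v \<Rightarrow> 'f) \<Rightarrow> 'f"
  where "double_form = (\<lambda>(x, a) (y, b). a y - b x)"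

end

theory Submission
  imports Defs
begin

text \<open>
  Part (a) is the instance \<open>\<rhd> = \<lhd> = \<cdot>\<close> of part (b). Evaluated at \<open>u \<in> A\<close>, the dual components of
  the two products in (b) are \<open>b (u \<lhd> x) - a (y \<lhd> u) + a (y \<rhd> u)\<close> and
  \<open>b (u \<lhd> x) - b (u \<rhd> x) + a (y \<rhd> u)\<close>, so every identity to be checked follows from the dialgebra
  axioms of \<open>A\<close>. Nondegeneracy of the form amounts to the fact that \<open>A\<^sup>*\<close> separates the points of \<open>A\<close>.
\<close>

section \<open>Dual spaces and direct sums\<close>

lemma bilinear_map_onI:
  assumes "\<And>x y. x \<in> V \<Longrightarrow> y \<in> V \<Longrightarrow> b x y \<in> W"
    and "\<And>x y z. x \<in> V \<Longrightarrow> y \<in> V \<Longrightarrow> z \<in> V \<Longrightarrow> b (x + y) z = b x z + b y z"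
    and "\<And>x y z. x \<in> V \<Longrightarrow> y \<in> V \<Longrightarrow> z \<in> V \<Longrightarrow> b x (y + z) = b x y + b x z"
    and "\<And>c x y. x \<in> V \<Longrightarrow> y \<in> V \<Longrightarrow> b (s c x) y = t c (b x y)"
    and "\<And>c x y. x \<in> V \<Longrightarrow> y \<in> V \<Longrightarrow> b x (s c y) = t c (b x y)"
  shows "bilinear_map_on s V t W b"
  using assms by (simp add: bilinear_map_on_def linear_map_on_def)

lemma vector_space_dual_scale:
  "vector_space (dual_scale :: 'f::field_char_0 \<Rightarrow> ('v \<Rightarrow> 'f) \<Rightarrow> 'v \<Rightarrow> 'f)"
  by unfold_locales (auto simp: dual_scale_def fun_eq_iff algebra_simps)

lemma dual_spaceI:
  assumes "\<And>x y. x \<in> V \<Longrightarrow> y \<in> V \<Longrightarrow> f (x + y) = f x + f y"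
    and "\<And>c x. x \<in> V \<Longrightarrow> f (s c x) = c * f x"
    and "\<And>x. x \<notin> V \<Longrightarrow> f x = 0"
  shows "f \<in> dual_space s V"
  using assms by (simp add: dual_space_def linear_map_on_def)

lemma dual_space_add: "f \<in> dual_space s V \<Longrightarrow> x \<in> V \<Longrightarrow> y \<in> V \<Longrightarrow> f (x + y) = f x + f y"
  and dual_space_scale: "f \<in> dual_space s V \<Longrightarrow> x \<in> V \<Longrightarrow> f (s c x) = c * f x"
  and dual_space_outside: "f \<in> dual_space s V \<Longrightarrow> x \<notin> V \<Longrightarrow> f x = 0"
  by (auto simp: dual_space_def linear_map_on_def)

section \<open>Bases, coordinate functionals and the dual of a carrier space\<close>

context fd_vector_space
begin

lemma subspace_carrier: "subspace V"
  using finite_dim subspace_span by blast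

text \<open>The locale only provides a finite spanning set. A maximal independent subset of it still
  spans \<open>V\<close> and inherits finiteness.\<close>

lemma finite_basis:
  obtains B where "finite B" "independent B" "span B = V"
proof -
  obtain C where C: "finite C" "span C = V"
    using finite_dim by blast
  obtain B where B: "B \<subseteq> C" "independent B" "C \<subseteq> span B"
    using maximal_independent_subset by blast
  have "span B = V"
    using B(3) C(2) span_mono[OF B(1)] span_minimal[OF B(3) subspace_span] by blast
  then show ?thesis
    using B(2) finite_subset[OF B(1) C(1)] that by simp
qed

text \<open>Both functions vanish outside \<open>V\<close> by the convention in
  \<open>dual_space\<close>, so agreement on \<open>V\<close> already gives equality as total
  functions.\<close>

lemma dual_space_eqI:
  assumes "f \<in> dual_space scale V" "g \<in> dual_space scale V" "\<And>x. x \<in> V \<Longrightarrow> f x = g x"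
  shows "f = g"
  using assms by (metis dual_space_outside ext)

lemma dual_space_diff:
  assumes "f \<in> dual_space scale V" "x \<in> V" "y \<in> V"
  shows "f (x - y) = f x - f y"
  using dual_space_add[OF assms(1) subspace_diff[OF subspace_carrier assms(2,3)] assms(3)] by simp

lemma representation_in_dual_space:
  assumes "independent B" "span B = V"
  shows "(\<lambda>x. representation B x b) \<in> dual_space scale V"
proof (rule dual_spaceI)
  \<comment> \<open>By definition \<open>representation\<close> takes the value 0 off
    \<open>span B\<close>, which matches the extension by 0 required of members of
    \<open>dual_space\<close>.\<close>
  show "representation B x b = 0" if "x \<notin> V" for x
    using that assms by (simp add: representation_def)
qed (use assms in \<open>auto simp: representation_add representation_scale\<close>)

text \<open>Each coordinate of \<open>x\<close> in a finite basis is the value of a functional at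
  \<open>x\<close>; if all these values vanish, so does the basis expansion of
  \<open>x\<close>.\<close>

lemma dual_space_separates:
  assumes "x \<in> V" "\<And>f. f \<in> dual_space scale V \<Longrightarrow> f x = 0"
  shows "x = 0"
proof -
  obtain B where B: "finite B" "independent B" "span B = V"
    by (rule finite_basis)
  have "x = (\<Sum>b\<in>B. scale (representation B x b) b)"
    using B assms(1) by (simp add: sum_representation_eq)
  also have "\<dots> = 0"
    using assms(2)[OF representation_in_dual_space[OF B(2,3)]] by simp
  finally show ?thesis .
qed

lemma subspace_dual_space: "module.subspace dual_scale (dual_space scale V)"
proof -
  interpret D: vector_space dual_scale
    by (rule vector_space_dual_scale)
  show ?thesis
    by (rule D.subspaceI)
      (auto intro!: dual_spaceI simp: dual_scale_def dual_space_add dual_space_scale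
        dual_space_outside algebra_simps)
qed

text \<open>Functionals are known to be additive only on \<open>V\<close>, so the induction also
  tracks that the partial sums stay in \<open>V\<close>.\<close>

lemma dual_space_sum:
  assumes "f \<in> dual_space scale V" "finite I" "\<And>i. i \<in> I \<Longrightarrow> v i \<in> V"
  shows "f (\<Sum>i\<in>I. scale (c i) (v i)) = (\<Sum>i\<in>I. c i * f (v i))"
  using assms(2,3)
proof (induction I)
  case empty
  \<comment> \<open>The empty sum requires \<open>f 0 = 0\<close>, which is homogeneity at the
    scalar 0.\<close>
  have "f (scale 0 0) = 0 * f 0"
    by (rule dual_space_scale[OF assms(1)]) (rule subspace_0[OF subspace_carrier])
  then show ?case by simp
next
  case (insert i I)
  have "(\<Sum>i\<in>I. scale (c i) (v i)) \<in> V" "scale (c i) (v i) \<in> V"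
    using insert by (auto intro!: subspace_sum subspace_scale subspace_carrier)
  with insert show ?case
    by (simp add: dual_space_add[OF assms(1)] dual_space_scale[OF assms(1)])
qed

text \<open>The coordinate functionals of a finite basis \<open>B\<close> span the dual: a
  functional \<open>f\<close> is their combination with coefficients \<open>f b\<close>.\<close>

lemma fd_vector_space_dual: "fd_vector_space dual_scale (dual_space scale V)"
proof -
  interpret D: vector_space "dual_scale :: 'f \<Rightarrow> ('v \<Rightarrow> 'f) \<Rightarrow> 'v \<Rightarrow> 'f"
    by (rule vector_space_dual_scale)
  obtain B where B: "finite B" "independent B" "span B = V"
    by (rule finite_basis)
  let ?e = "\<lambda>b x. representation B x b"
  have eD: "?e b \<in> dual_space scale V" for b
    by (rule representation_in_dual_space[OF B(2,3)])
  have "D.span (?e ` B) = dual_space scale V"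
  proof (rule D.span_subspace)
    show "?e ` B \<subseteq> dual_space scale V"
      using eD by blast
    show "D.subspace (dual_space scale V)"
      by (rule subspace_dual_space)
    show "dual_space scale V \<subseteq> D.span (?e ` B)"
    proof
      fix f assume f: "f \<in> dual_space scale V"
      let ?g = "\<Sum>b\<in>B. dual_scale (f b) (?e b)"
      have g: "?g \<in> dual_space scale V"
        by (intro D.subspace_sum D.subspace_scale subspace_dual_space eD)
      have "f = ?g"
      proof (rule dual_space_eqI[OF f g])
        fix x assume x: "x \<in> V"
        have "B \<subseteq> V"
          using B(3) span_superset by blast
        have "f x = f (\<Sum>b\<in>B. scale (?e b x) b)"
          using B x by (simp add: sum_representation_eq)
        also have "\<dots> = (\<Sum>b\<in>B. ?e b x * f b)"
          using \<open>B \<subseteq> V\<close> by (intro dual_space_sum f B(1)) auto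
        also have "\<dots> = ?g x"
        proof -
          \<comment> \<open>The sum \<open>?g\<close> is taken in a function type, so evaluating it
            at \<open>x\<close> means moving the evaluation inside the sum.\<close>
          have "sum h B x = (\<Sum>b\<in>B. h b x)" for h :: "'v \<Rightarrow> 'v \<Rightarrow> 'f"
            using B(1) by induction auto
          then show ?thesis
            by (simp add: dual_scale_def mult.commute)
        qed
        finally show "f x = ?g x" .
      qed
      also have "?g \<in> D.span (?e ` B)"
        by (intro D.span_sum D.span_scale D.span_base) auto
      finally show "f \<in> D.span (?e ` B)" .
    qed
  qed
  then show ?thesis
    using B(1) by unfold_locales blast
qed

end

text \<open>If \<open>B\<close> spans \<open>V\<close> and \<open>C\<close> spans \<open>W\<close>,
  then the copies of \<open>B\<close> and \<open>C\<close> on the two axes together span the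
  product.\<close>

lemma fd_vector_space_Times:
  assumes "fd_vector_space s V" "fd_vector_space t W"
  shows "fd_vector_space (module_prod.scale s t) (V \<times> W)"
proof -
  interpret V: fd_vector_space s V by fact
  interpret W: fd_vector_space t W by fact
  interpret P: vector_space_prod s t ..
  obtain B C where B: "finite B" "V.span B = V" and C: "finite C" "W.span C = W"
    using V.finite_dim W.finite_dim by blast
  have "P.p.span (B \<times> {0} \<union> {0} \<times> C) = V \<times> W"
    by (auto simp: P.p.span_Un P.span_Times_sing1 P.span_Times_sing2 B C)
  moreover have "finite (B \<times> {0} \<union> {0} \<times> C)"
    using B(1) C(1) by simp
  ultimately show ?thesis
    by unfold_locales blast
qed

lemma (in fd_vector_space) fd_vector_space_double:
  "fd_vector_space (double_scale scale) (V \<times> dual_space scale V)"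
  unfolding double_scale_def
  by (rule fd_vector_space_Times[OF fd_vector_space_axioms fd_vector_space_dual])

lemma (in fd_vector_space) double_scale_Pair:
  "double_scale scale c (x, f) = (scale c x, dual_scale c f)"
proof -
  interpret D: vector_space "dual_scale :: 'f \<Rightarrow> ('v \<Rightarrow> 'f) \<Rightarrow> 'v \<Rightarrow> 'f"
    by (rule vector_space_dual_scale)
  interpret P: vector_space_prod scale "dual_scale :: 'f \<Rightarrow> ('v \<Rightarrow> 'f) \<Rightarrow> 'v \<Rightarrow> 'f" ..
  show ?thesis
    unfolding double_scale_def by (rule P.scale_prod)
qed

lemma double_form_Pair [simp]: "double_form (x, a) (y, b) = a y - b x"
  by (simp add: double_form_def)

section \<open>The double of a dialgebra\<close>

text \<open>The body keeps the formula of part (b) literally, so that unfolding yields the final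
  statement; computations go through the evaluated form \<open>double_rt_Pair\<close>.\<close>

definition double_rt ::
  "'v set \<Rightarrow> ('v \<Rightarrow> 'v \<Rightarrow> 'v) \<Rightarrow> ('v \<Rightarrow> 'v \<Rightarrow> 'v) \<Rightarrow>
   'v \<times> ('v \<Rightarrow> 'f::field_char_0) \<Rightarrow> 'v \<times> ('v \<Rightarrow> 'f) \<Rightarrow> 'v \<times> ('v \<Rightarrow> 'f)"
  where "double_rt A rt lt = (\<lambda>(x, a) (y, b).
    (rt x y,
     - dual_map A (right_mult lt) x b
     + (dual_map A (left_mult lt) - dual_map A (left_mult rt)) y a))"

definition double_lt ::
  "'v set \<Rightarrow> ('v \<Rightarrow> 'v \<Rightarrow> 'v) \<Rightarrow> ('v \<Rightarrow> 'v \<Rightarrow> 'v) \<Rightarrow>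
   'v \<times> ('v \<Rightarrow> 'f::field_char_0) \<Rightarrow> 'v \<times> ('v \<Rightarrow> 'f) \<Rightarrow> 'v \<times> ('v \<Rightarrow> 'f)"
  where "double_lt A rt lt = (\<lambda>(x, a) (y, b).
    (lt x y,
     (dual_map A (right_mult rt) - dual_map A (right_mult lt)) x b
     - dual_map A (left_mult rt) y a))"

lemma double_rt_Pair:
  "double_rt A rt lt (x, a) (y, b) =
    (rt x y, \<lambda>u. if u \<in> A then b (lt u x) - a (lt y u) + a (rt y u) else 0)"
  by (auto simp: double_rt_def dual_map_def left_mult_def right_mult_def fun_eq_iff)

lemma double_lt_Pair:
  "double_lt A rt lt (x, a) (y, b) =
    (lt x y, \<lambda>u. if u \<in> A then b (lt u x) - b (rt u x) + a (rt y u) else 0)"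
  by (auto simp: double_lt_def dual_map_def left_mult_def right_mult_def fun_eq_iff)

context associative_algebra
begin

lemma mult_closed: "x \<in> A \<Longrightarrow> y \<in> A \<Longrightarrow> x \<cdot> y \<in> A"
  and mult_add_left: "x \<in> A \<Longrightarrow> y \<in> A \<Longrightarrow> z \<in> A \<Longrightarrow> (x + y) \<cdot> z = x \<cdot> z + y \<cdot> z"
  and mult_add_right: "x \<in> A \<Longrightarrow> y \<in> A \<Longrightarrow> z \<in> A \<Longrightarrow> x \<cdot> (y + z) = x \<cdot> y + x \<cdot> z"
  and mult_scale_left: "x \<in> A \<Longrightarrow> y \<in> A \<Longrightarrow> scale c x \<cdot> y = scale c (x \<cdot> y)"
  and mult_scale_right: "x \<in> A \<Longrightarrow> y \<in> A \<Longrightarrow> x \<cdot> scale c y = scale c (x \<cdot> y)"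
  using bilinear_mult by (auto simp: bilinear_map_on_def linear_map_on_def)

text \<open>When the two products coincide, each of the three mixed axioms is associativity.\<close>

lemma dialgebra_self: "dialgebra scale A mult mult"
  by unfold_locales (auto simp: mult_assoc)

end

section \<open>Dialgebra axioms and the invariant form on the double\<close>

context dialgebra
begin

lemmas product_simps =
  R.mult_closed L.mult_closed
  R.mult_add_left L.mult_add_left R.mult_add_right L.mult_add_right
  R.mult_scale_left L.mult_scale_left R.mult_scale_right L.mult_scale_right
  R.subspace_add[OF R.subspace_carrier] R.subspace_scale[OF R.subspace_carrier]

text \<open>The dual component is linear in its argument \<open>u\<close> because both products are
  linear in each variable on \<open>A\<close>; the \<open>if\<close> makes it vanish outside
  \<open>A\<close>.\<close>

lemma double_rt_closed:
  assumes "x \<in> A" "y \<in> A" "a \<in> dual_space scale A" "b \<in> dual_space scale A"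
  shows "double_rt A (\<rhd>) (\<lhd>) (x, a) (y, b) \<in> A \<times> dual_space scale A"
  using assms unfolding double_rt_Pair
  by (auto intro!: dual_spaceI simp: product_simps dual_space_add dual_space_scale algebra_simps)

lemma double_lt_closed:
  assumes "x \<in> A" "y \<in> A" "a \<in> dual_space scale A" "b \<in> dual_space scale A"
  shows "double_lt A (\<rhd>) (\<lhd>) (x, a) (y, b) \<in> A \<times> dual_space scale A"
  using assms unfolding double_lt_Pair
  by (auto intro!: dual_spaceI simp: product_simps dual_space_add dual_space_scale algebra_simps)

lemma bilinear_double_rt:
  "bilinear_map_on (double_scale scale) (A \<times> dual_space scale A)
    (double_scale scale) (A \<times> dual_space scale A) (double_rt A (\<rhd>) (\<lhd>))"
proof (rule bilinear_map_onI, goal_cases)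
  case (1 p q)
  then show ?case by (cases p; cases q) (use double_rt_closed in auto)
qed (auto simp: double_rt_Pair R.double_scale_Pair dual_scale_def fun_eq_iff product_simps
    dual_space_add dual_space_scale algebra_simps)

lemma bilinear_double_lt:
  "bilinear_map_on (double_scale scale) (A \<times> dual_space scale A)
    (double_scale scale) (A \<times> dual_space scale A) (double_lt A (\<rhd>) (\<lhd>))"
proof (rule bilinear_map_onI, goal_cases)
  case (1 p q)
  then show ?case by (cases p; cases q) (use double_lt_closed in auto)
qed (auto simp: double_lt_Pair R.double_scale_Pair dual_scale_def fun_eq_iff product_simps
    dual_space_add dual_space_scale algebra_simps)

text \<open>Both sides equal \<open>(x \<lhd> y) \<lhd> z\<close>, one by associativity of \<lhd>
  and the other by the first mixed axiom.\<close>

lemma lt_lt_right: "x \<in> A \<Longrightarrow> y \<in> A \<Longrightarrow> z \<in> A \<Longrightarrow> x \<lhd> (y \<lhd> z) = x \<lhd> (y \<rhd> z)"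
  using L.mult_assoc lt_lt_eq_lt_rt by simp

text \<open>
  Rewrites every triple product to one of the normal forms \<open>x \<rhd> (y \<rhd> z)\<close>, \<open>x \<rhd> (y \<lhd> z)\<close> and
  \<open>x \<lhd> (y \<rhd> z)\<close>; associativity of \<open>\<lhd>\<close> is left out as it would break confluence.
\<close>
lemmas triple_simps =
  R.mult_assoc lt_lt_eq_lt_rt rt_lt_assoc lt_rt_eq_rt_rt lt_lt_right

text \<open>At a point \<open>u\<close> of \<open>A\<close>, the dual component of each axiom is a
  signed sum of values of the three functionals at triple products, one factor being
  \<open>u\<close>. Bringing these arguments to normal form makes the two sides agree, sometimes
  after cancellations such as that of \<open>a (y \<lhd> (z \<lhd> u))\<close> against
  \<open>a (y \<lhd> (z \<rhd> u))\<close>.\<close>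

lemma dialgebra_double:
  "dialgebra (double_scale scale) (A \<times> dual_space scale A)
    (double_rt A (\<rhd>) (\<lhd>)) (double_lt A (\<rhd>) (\<lhd>))"
proof -
  interpret D: fd_vector_space "double_scale scale" "A \<times> dual_space scale A"
    by (rule R.fd_vector_space_double)
  show ?thesis
  \<comment> \<open>Goals 1 and 3 are bilinearity of the two products; the other goals are the two
    associativity laws and the three mixed axioms.\<close>
  proof (unfold_locales, goal_cases)
    case 1
    show ?case by (rule bilinear_double_rt)
  next
    case 3
    show ?case by (rule bilinear_double_lt)
  qed (auto simp: double_rt_Pair double_lt_Pair fun_eq_iff R.mult_closed L.mult_closed triple_simps)
qed

lemma skew_frobenius_dialgebra_double:
  "skew_frobenius_dialgebra (double_scale scale) (A \<times> dual_space scale A)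
    (double_rt A (\<rhd>) (\<lhd>)) (double_lt A (\<rhd>) (\<lhd>)) double_form"
proof -
  interpret D: dialgebra "double_scale scale" "A \<times> dual_space scale A"
    "double_rt A (\<rhd>) (\<lhd>)" "double_lt A (\<rhd>) (\<lhd>)"
    by (rule dialgebra_double)
  have zero_mem: "0 \<in> A" "0 \<in> dual_space scale A"
    using R.subspace_0[OF R.subspace_carrier] by (auto intro: dual_spaceI)
  have skew: "double_form p q = - double_form q p" for p q :: "'v \<times> ('v \<Rightarrow> 'f)"
    by (cases p; cases q) simp
  \<comment> \<open>Testing \<open>(x, a)\<close> against \<open>(y, 0)\<close> gives
    \<open>a y = 0\<close>, hence \<open>a = 0\<close>. Testing against \<open>(0, f)\<close> then
    leaves \<open>- f x = 0\<close> for every functional \<open>f\<close>, and these separate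
    points.\<close>
  have nondeg: "p = 0"
    if p: "p \<in> A \<times> dual_space scale A"
      and orth: "\<And>q. q \<in> A \<times> dual_space scale A \<Longrightarrow> double_form p q = 0" for p
  proof -
    obtain x a where xa: "p = (x, a)" "x \<in> A" "a \<in> dual_space scale A"
      using p by blast
    have "a y = 0" if "y \<in> A" for y
      using orth[of "(y, 0)"] that zero_mem xa by simp
    then have "a = 0"
      by (intro R.dual_space_eqI[OF xa(3) zero_mem(2)]) simp
    moreover have "x = 0"
    proof (rule R.dual_space_separates[OF xa(2)])
      show "f x = 0" if "f \<in> dual_space scale A" for f
        using orth[of "(0, f)"] that zero_mem xa \<open>a = 0\<close> by simp
    qed
    ultimately show ?thesis
      by (simp add: xa zero_prod_def)
  qed
  show ?thesis
  proof (unfold_locales, goal_cases)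
    case 1
    show ?case
      by (rule bilinear_map_onI)
        (auto simp: R.double_scale_Pair dual_scale_def dual_space_add dual_space_scale algebra_simps)
  next
    case (2 p q)
    show ?case by (rule skew)
  next
    case (3 p)
    then show ?case using nondeg by blast
  next
    case (4 p)
    \<comment> \<open>Skew-symmetry turns right orthogonality into left orthogonality.\<close>
    then show ?case using nondeg skew by (metis neg_equal_0_iff_equal)
  \<comment> \<open>The remaining goals are the two invariance identities, which follow by
    evaluation. For \<rhd> the term \<open>a (y \<rhd> z - y \<lhd> z)\<close> has to be split,
    which is the purpose of \<open>R.dual_space_diff\<close>.\<close>
  qed (auto simp: double_rt_Pair double_lt_Pair R.mult_closed L.mult_closed R.dual_space_diff)
qed

end

text \<open>For equal products the differences of dual maps in part (b) cancel, leaving the products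
  of part (a).\<close>

lemma double_rt_self:
  "double_rt A m m = (\<lambda>(x, a) (y, b). (m x y, - dual_map A (right_mult m) x b))"
  and double_lt_self:
  "double_lt A m m = (\<lambda>(x, a) (y, b). (m x y, - dual_map A (left_mult m) y a))"
  by (auto simp: double_rt_def double_lt_def)

theorem proposition2p20:
  fixes scale :: "'f::field_char_0 \<Rightarrow> 'v::ab_group_add \<Rightarrow> 'v" and A :: "'v set"
  assumes "fd_vector_space scale A"
  shows
    "(\<forall>m. associative_algebra scale A m \<longrightarrow>
        skew_frobenius_dialgebra (double_scale scale) (A \<times> dual_space scale A)
          (\<lambda>(x, a) (y, b). (m x y, - dual_map A (right_mult m) x b))
          (\<lambda>(x, a) (y, b). (m x y, - dual_map A (left_mult m) y a))
          double_form) \<and>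
     (\<forall>rt lt. dialgebra scale A rt lt \<longrightarrow>
        skew_frobenius_dialgebra (double_scale scale) (A \<times> dual_space scale A)
          (\<lambda>(x, a) (y, b).
            (rt x y,
             - dual_map A (right_mult lt) x b
             + (dual_map A (left_mult lt) - dual_map A (left_mult rt)) y a))
          (\<lambda>(x, a) (y, b).
            (lt x y,
             (dual_map A (right_mult rt) - dual_map A (right_mult lt)) x b
             - dual_map A (left_mult rt) y a))
          double_form)"
proof (intro conjI allI impI)
  fix m assume "associative_algebra scale A m"
  then have "dialgebra scale A m m"
    by (rule associative_algebra.dialgebra_self)
  from dialgebra.skew_frobenius_dialgebra_double[OF this]
  show "skew_frobenius_dialgebra (double_scale scale) (A \<times> dual_space scale A)
      (\<lambda>(x, a) (y, b). (m x y, - dual_map A (right_mult m) x b))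
      (\<lambda>(x, a) (y, b). (m x y, - dual_map A (left_mult m) y a)) double_form"
    by (simp only: double_rt_self double_lt_self)
next
  fix rt lt assume "dialgebra scale A rt lt"
  from dialgebra.skew_frobenius_dialgebra_double[OF this, unfolded double_rt_def double_lt_def]
  show "skew_frobenius_dialgebra (double_scale scale) (A \<times> dual_space scale A)
      (\<lambda>(x, a) (y, b).
        (rt x y,
         - dual_map A (right_mult lt) x b
         + (dual_map A (left_mult lt) - dual_map A (left_mult rt)) y a))
      (\<lambda>(x, a) (y, b).
        (lt x y,
         (dual_map A (right_mult rt) - dual_map A (right_mult lt)) x b
         - dual_map A (left_mult rt) y a))
      double_form" .
qed

end
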